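(* Let $\omega>0$ and $n\in\{0,1,2,\ldots\}$. The function $$P_n^\omega(z)=z^n\,{}_2F_1\!\left[\begin{array}{l}-n,-\omega;\\-n-\omega;\end{array}-\frac1z\right]=\sum_{\ell=0}^n (-1)^\ell\,\frac{(-n)_\ell(-\omega)_\ell}{\ell!\,(-n-\omega)_\ell}\,z^{n-\ell}$$ is a monic polynomial of degree $n$ satisfying $\langle P_n^\omega,z^k\rangle_\omega=0$ for $k=0,1,\ldots,n-1$. Moreover, if $\omega$ is not an integer, it is the unique monic polynomial of degree $n$ with this property. In other words, the monic orthogonal polynomials $\mathcal{S}_n^\omega$ with respect to $\langle\cdot,\cdot\rangle_\omega$ (the skyburst polynomials) are given by $\mathcal{S}_n^\omega=P_n^\omega$.
   Context: For $\omega\in\mathbb{R}\setminus\{0\}$ and complex polynomials $f,g$, set $$\langle f,g\rangle_\omega=\frac{1}{2\pi}\int_{-\pi}^{\pi} f(e^{i\theta})\,\overline{g(e^{i\theta})}\,e^{i\omega\theta}\,d\theta,$$ which corresponds to the complex-valued measure $z^{\omega-1}\,dz$ on the unit circle (with $z^\omega=e^{i\omega\theta}$ for $z=e^{i\theta}$, $\theta\in(-\pi,\pi)$). In particular $\langle z^j,z^k\rangle_\omega=\frac1{2\pi}\int_{-\pi}^\pi e^{i(j-k+\omega)\theta}d\theta$. Here $(a)_\ell=a(a+1)\cdots(a+\ell-1)$, $(a)_0=1$, is the Pochhammer symbol. *)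

theory Defs
  imports "HOL-Analysis.Analysis" "HOL-Computational_Algebra.Computational_Algebra"
begin

definition ip :: "real \<Rightarrow> complex poly \<Rightarrow> complex poly \<Rightarrow> complex" where
  "ip \<omega> f g = 1 / (2 * of_real pi) *
     integral {-pi..pi} (\<lambda>\<theta>. poly f (cis \<theta>) * cnj (poly g (cis \<theta>)) * cis (\<omega> * \<theta>))"

(* Where (c)_l vanishes, HOL's x / 0 = 0 drops the term. For a = -n, b = -\<omega>, c = -n - \<omega>
   with \<omega> > 0 this only concerns l > n, where (a)_l = 0 already. *)
definition hyp2F1 :: "complex \<Rightarrow> complex \<Rightarrow> complex \<Rightarrow> complex \<Rightarrow> complex" where
  "hyp2F1 a b c z = eval_fps (fps_hypergeo [a, b] [c] 1) z"

definition P :: "real \<Rightarrow> nat \<Rightarrow> complex poly" where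
  "P \<omega> n = (\<Sum>l\<le>n. monom ((-1) ^ l *
     (pochhammer (- of_nat n) l * pochhammer (- of_real \<omega>) l) /
     (fact l * pochhammer (- of_nat n - of_real \<omega>) l)) (n - l))"

(* The k-th orthogonality relation is against z^k in the second (conjugated) argument; the form
   is not Hermitian, so the order matters. *)
definition monic_orthogonal :: "real \<Rightarrow> nat \<Rightarrow> complex poly \<Rightarrow> bool" where
  "monic_orthogonal \<omega> n p \<longleftrightarrow>
     degree p = n \<and> lead_coeff p = 1 \<and> (\<forall>k<n. ip \<omega> p (monom 1 k) = 0)"

(* Only meaningful when a monic orthogonal polynomial of degree n is unique;
   uniqueness can fail for integer \<omega>. *)
definition skyburst :: "real \<Rightarrow> nat \<Rightarrow> complex poly" where
  "skyburst \<omega> n = (THE p. monic_orthogonal \<omega> n p)"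

end

theory Submission
  imports Defs
begin

text \<open>
  The coefficient of $z^{n-l}$ in $P_n^\omega$ is
  ${n \choose l}\,(\omega-l+1)_n/(\omega+1)_n$. Its factor $(\omega-l+1)_n$ contains
  $\omega+n-l-k$ for every $k<n$, and this is exactly the denominator of the moment
  $\langle z^{n-l},z^k\rangle_\omega$, whose numerator is $(-1)^l$ up to a constant. So
  $\langle P_n^\omega,z^k\rangle_\omega$ is an $n$-th finite difference of a polynomial of degree
  $n-1$, hence zero. Uniqueness is the regularity of the Cauchy matrix $1/(\omega+j-k)$: a kernel
  vector yields a polynomial of degree below $n$ with the roots $0,\dots,n-1$.
\<close>

section \<open>Finite differences of polynomials\<close>

text \<open>The shift by one preserves both degree and leading coefficient, so the top terms cancel.
  Positive degree rules out a constant, whose difference is zero and again has degree 0.\<close>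

lemma degree_diff_shift_less:
  fixes p :: "'a::idom poly"
  assumes "degree p > 0"
  shows "degree (p - p \<circ>\<^sub>p [:1, 1:]) < degree p"
proof -
  have deg: "degree (p \<circ>\<^sub>p [:1, 1:]) = degree p"
    by (simp add: degree_pcompose)
  then have "coeff (p - p \<circ>\<^sub>p [:1, 1:]) (degree p) = 0"
    using lead_coeff_comp[of "[:1, 1:]" p] by simp
  moreover have "degree (p - p \<circ>\<^sub>p [:1, 1:]) \<le> degree p"
    using deg by (intro degree_diff_le) auto
  ultimately show ?thesis
    using eq_zero_or_degree_less assms by fastforce
qed

text \<open>Pascal's rule, read as the recursion for iterated differences: the induction step for
  \<open>alternating_binomial_sum_poly\<close>.\<close>

lemma alternating_binomial_sum_Suc:
  fixes f :: "nat \<Rightarrow> 'a::comm_ring_1"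
  shows "(\<Sum>l\<le>Suc n. (-1) ^ l * of_nat (Suc n choose l) * f l)
       = (\<Sum>l\<le>n. (-1) ^ l * of_nat (n choose l) * (f l - f (Suc l)))"
proof -
  define A where "A = (\<Sum>l\<le>n. (-1) ^ l * of_nat (n choose l) * f l)"
  define B where "B = (\<Sum>l\<le>n. (-1) ^ l * of_nat (n choose Suc l) * f (Suc l))"
  define D where "D = (\<Sum>l\<le>n. (-1) ^ l * of_nat (n choose l) * f (Suc l))"
  have A: "A = f 0 - B"
  proof -
    \<comment> \<open>The added term vanishes since \<open>n choose Suc n\<close> is 0; splitting
      off \<open>l = 0\<close> then shifts the index and flips the sign.\<close>
    have "A = (\<Sum>l\<le>Suc n. (-1) ^ l * of_nat (n choose l) * f l)"
      by (simp add: A_def binomial_eq_0)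
    also have "\<dots> = f 0 - B"
      unfolding sum.atMost_Suc_shift by (simp add: B_def sum_negf)
    finally show ?thesis .
  qed
  have DB: "(\<Sum>l\<le>n. (-1) ^ Suc l * of_nat (Suc n choose Suc l) * f (Suc l)) = - (D + B)"
    unfolding B_def D_def sum.distrib[symmetric] sum_negf[symmetric]
    by (intro sum.cong) (simp_all add: algebra_simps)
  have "(\<Sum>l\<le>Suc n. (-1) ^ l * of_nat (Suc n choose l) * f l) = f 0 - (D + B)"
    unfolding sum.atMost_Suc_shift DB by simp
  also have "\<dots> = A - D"
    by (simp add: A)
  also have "\<dots> = (\<Sum>l\<le>n. (-1) ^ l * of_nat (n choose l) * (f l - f (Suc l)))"
    by (simp add: A_def D_def right_diff_distrib sum_subtractf)
  finally show ?thesis .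
qed

text \<open>Each difference lowers the degree, so \<open>n\<close> of them annihilate the
  polynomial.\<close>

lemma alternating_binomial_sum_poly:
  fixes p :: "'a::idom poly"
  assumes "degree p < n"
  shows "(\<Sum>l\<le>n. (-1) ^ l * of_nat (n choose l) * poly p (of_nat l)) = 0"
  using assms
proof (induction n arbitrary: p)
  case (Suc n)
  define q where "q = p - p \<circ>\<^sub>p [:1, 1:]"
  have "(\<Sum>l\<le>Suc n. (-1) ^ l * of_nat (Suc n choose l) * poly p (of_nat l))
      = (\<Sum>l\<le>n. (-1) ^ l * of_nat (n choose l) * poly q (of_nat l))"
    unfolding alternating_binomial_sum_Suc by (simp add: q_def poly_pcompose)
  also have "\<dots> = 0"
  \<comment> \<open>A constant needs its own case: its difference is the zero polynomial, and
    \<open>n\<close> may be 0 here.\<close>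
  proof (cases "degree p = 0")
    case True
    then obtain a where "p = [:a:]" by (auto elim: degree_eq_zeroE)
    then show ?thesis by (simp add: q_def)
  next
    case False
    then have "degree q < n"
      using degree_diff_shift_less[of p] Suc.prems by (simp add: q_def)
    then show ?thesis by (rule Suc.IH)
  qed
  finally show ?case .
qed simp

section \<open>Regularity of Cauchy matrices\<close>

text \<open>Over a common denominator, the rational function with terms
  \<open>a j / (w + j - x)\<close> has a numerator \<open>N\<close> of degree below
  \<open>n\<close>. The equations give it \<open>n\<close> roots, so it vanishes, and its value at
  the pole \<open>w + m\<close> isolates \<open>a m\<close>.\<close>

lemma cauchy_system_trivial:
  fixes a :: "nat \<Rightarrow> 'a::field_char_0" and w :: 'a
  assumes nz: "\<And>j k. j < n \<Longrightarrow> k < n \<Longrightarrow> w + of_nat j - of_nat k \<noteq> 0"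
    and eq: "\<And>k. k < n \<Longrightarrow> (\<Sum>j<n. a j / (w + of_nat j - of_nat k)) = 0"
    and "m < n"
  shows "a m = 0"
proof -
  define N where
    "N = (\<Sum>j<n. smult (a j) (\<Prod>i\<in>{..<n} - {j}. [:w + of_nat i, -1:]))"
  have N: "poly N x = (\<Sum>j<n. a j * (\<Prod>i\<in>{..<n} - {j}. w + of_nat i - x))" for x
    by (simp add: N_def poly_sum poly_prod)
  have "degree N < n"
  proof -
    have "degree (smult (a j) (\<Prod>i\<in>{..<n} - {j}. [:w + of_nat i, -1:])) \<le> n - 1"
      if "j < n" for j
    proof -
      have "degree (\<Prod>i\<in>{..<n} - {j}. [:w + of_nat i, -1:]) \<le> n - 1"
        using that by (subst degree_prod_eq_sum_degree) auto
      then show ?thesis by (rule le_trans[OF degree_smult_le])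
    qed
    then have "degree N \<le> n - 1"
      unfolding N_def by (intro degree_sum_le) auto
    then show ?thesis using \<open>m < n\<close> by simp
  qed
  have root: "poly N (of_nat k) = 0" if k: "k < n" for k
  proof -
    have "poly N (of_nat k)
        = (\<Sum>j<n. (\<Prod>i<n. w + of_nat i - of_nat k) * (a j / (w + of_nat j - of_nat k)))"
      unfolding N
    proof (rule sum.cong[OF refl])
      fix j assume "j \<in> {..<n}"
      then show "a j * (\<Prod>i\<in>{..<n} - {j}. w + of_nat i - of_nat k)
          = (\<Prod>i<n. w + of_nat i - of_nat k) * (a j / (w + of_nat j - of_nat k))"
        using nz[of j k] k
        by (subst prod.remove[of "{..<n}" j]) auto
    qed
    also have "\<dots> = 0"
      unfolding sum_distrib_left[symmetric] eq[OF k] by simp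
    finally show ?thesis .
  qed
  have "N = 0"
  proof (rule ccontr)
    assume "N \<noteq> 0"
    \<comment> \<open>Characteristic 0 makes these \<open>n\<close> roots distinct.\<close>
    have "card (of_nat ` {..<n} :: 'a set) \<le> card {x. poly N x = 0}"
      using root poly_roots_finite[OF \<open>N \<noteq> 0\<close>] by (intro card_mono) auto
    also have "\<dots> \<le> degree N"
      using \<open>N \<noteq> 0\<close> by (rule card_poly_roots_bound)
    finally show False
      using \<open>degree N < n\<close> by (simp add: card_image inj_on_def)
  qed
  then have "0 = poly N (w + of_nat m)" by simp
  \<comment> \<open>For \<open>j\<close> other than \<open>m\<close> the product contains the factor
    with \<open>i = m\<close>, which is zero at this point.\<close>
  also have "\<dots> = (\<Sum>j<n. if j = m then a m * (\<Prod>i\<in>{..<n} - {m}. of_nat i - of_nat m) else 0)"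
    unfolding N
  proof (rule sum.cong[OF refl])
    fix j assume "j \<in> {..<n}"
    then show "a j * (\<Prod>i\<in>{..<n} - {j}. w + of_nat i - (w + of_nat m))
        = (if j = m then a m * (\<Prod>i\<in>{..<n} - {m}. of_nat i - of_nat m) else 0)"
      using \<open>m < n\<close> by (auto intro!: prod_zero bexI[of _ m])
  qed
  also have "\<dots> = a m * (\<Prod>i\<in>{..<n} - {m}. of_nat i - of_nat m)"
    using \<open>m < n\<close> by simp
  finally show ?thesis by (auto simp: prod_zero_iff)
qed

section \<open>Moments of the form \<open>ip\<close>\<close>

text \<open>The factor \<open>a\<close> stays on the left-hand side so that \<open>a = 0\<close> needs no separate case.\<close>

lemma integral_cis:
  "of_real a * integral {-pi..pi} (\<lambda>\<theta>. cis (a * \<theta>)) = 2 * of_real (sin (pi * a))"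
proof -
  have "((\<lambda>\<theta>. of_real a * cis (a * \<theta>)) has_integral
          (- \<i> * cis (a * pi)) - (- \<i> * cis (a * - pi))) {-pi..pi}"
  proof (rule fundamental_theorem_of_calculus)
    fix x
    show "((\<lambda>\<theta>. - \<i> * cis (a * \<theta>)) has_vector_derivative of_real a * cis (a * x))
            (at x within {-pi..pi})"
      unfolding has_vector_derivative_def
      by (rule derivative_eq_intros refl | simp add: scaleR_conv_of_real fun_eq_iff algebra_simps)+
  qed simp
  moreover have "(- \<i> * cis (a * pi)) - (- \<i> * cis (a * - pi)) = 2 * of_real (sin (pi * a))"
    by (simp add: complex_eq_iff mult.commute)
  ultimately show ?thesis
    by (metis integral_mult_right integral_unique)
qed

text \<open>The bound \<open>N\<close> is free, rather than tied to \<open>degree f\<close>, so that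
  several polynomials can be expanded over one index range.\<close>

lemma ip_monom:
  assumes "\<And>j. j \<ge> N \<Longrightarrow> coeff f j = 0"
  shows "2 * of_real pi * ip \<omega> f (monom 1 k)
       = (\<Sum>j<N. coeff f j * integral {-pi..pi} (\<lambda>\<theta>. cis ((\<omega> + real j - real k) * \<theta>)))"
proof -
  have poly_f: "poly f x = (\<Sum>j<N. coeff f j * x ^ j)" for x
  proof -
    \<comment> \<open>A range containing both \<open>{..degree f}\<close> and \<open>{..<N}\<close>,
      as neither need contain the other.\<close>
    have "poly f x = (\<Sum>j\<le>degree f + N. coeff f j * x ^ j)"
      unfolding poly_altdef by (rule sum.mono_neutral_left) (auto simp: coeff_eq_0)
    also have "\<dots> = (\<Sum>j<N. coeff f j * x ^ j)"
      by (rule sum.mono_neutral_right) (use assms in auto)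
    finally show ?thesis .
  qed
  have "poly f (cis \<theta>) * cnj (poly (monom 1 k) (cis \<theta>)) * cis (\<omega> * \<theta>)
      = (\<Sum>j<N. coeff f j * cis ((\<omega> + real j - real k) * \<theta>))" for \<theta>
  proof -
    have "cis \<theta> ^ j * cnj (cis \<theta> ^ k) * cis (\<omega> * \<theta>) = cis ((\<omega> + real j - real k) * \<theta>)" for j
      by (simp add: Complex.DeMoivre cis_cnj cis_mult algebra_simps)
    then show ?thesis
      by (simp add: poly_f poly_monom sum_distrib_right mult.assoc)
  qed
  moreover have "integral {-pi..pi} (\<lambda>\<theta>. \<Sum>j<N. coeff f j * cis ((\<omega> + real j - real k) * \<theta>))
     = (\<Sum>j<N. coeff f j * integral {-pi..pi} (\<lambda>\<theta>. cis ((\<omega> + real j - real k) * \<theta>)))"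
    by (subst integral_sum)
       (auto intro!: integrable_continuous_real continuous_intros)
  ultimately show ?thesis by (simp add: ip_def)
qed

lemma ip_diff_monom:
  "ip \<omega> (f - g) (monom 1 k) = ip \<omega> f (monom 1 k) - ip \<omega> g (monom 1 k)"
proof -
  define N where "N = Suc (degree f + degree g)"
  have expand: "2 * of_real pi * ip \<omega> h (monom 1 k)
      = (\<Sum>j<N. coeff h j * integral {-pi..pi} (\<lambda>\<theta>. cis ((\<omega> + real j - real k) * \<theta>)))"
    if "degree h < N" for h
    by (rule ip_monom) (use that in \<open>simp add: coeff_eq_0\<close>)
  have "degree f < N" "degree g < N" "degree (f - g) < N"
    by (auto simp: N_def intro!: degree_diff_less)
  then have "2 * of_real pi * ip \<omega> (f - g) (monom 1 k)
      = 2 * of_real pi * ip \<omega> f (monom 1 k) - 2 * of_real pi * ip \<omega> g (monom 1 k)"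
    by (simp only: expand coeff_diff left_diff_distrib sum_subtractf)
  also have "\<dots> = 2 * of_real pi * (ip \<omega> f (monom 1 k) - ip \<omega> g (monom 1 k))"
    by (rule right_diff_distrib[symmetric])
  finally show ?thesis
    by (subst (asm) mult_cancel_left) simp
qed

lemma sin_add_int_pi:
  "sin (pi * (x + real m - real k)) = (-1) ^ (m + k) * sin (pi * x)"
proof -
  have "pi * (x + real m - real k) = (pi * x + real m * pi) - real k * pi"
    by (simp add: algebra_simps)
  then show ?thesis
    by (simp add: sin_diff sin_add cos_add power_add)
qed

section \<open>Coefficients of \<open>P\<close>\<close>

lemma coeff_P:
  assumes "l \<le> n"
  shows "coeff (P \<omega> n) (n - l) = (-1) ^ l *
     (pochhammer (- of_nat n) l * pochhammer (- of_real \<omega>) l) /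
     (fact l * pochhammer (- of_nat n - of_real \<omega>) l)"
proof -
  define c :: "nat \<Rightarrow> complex" where "c l = (-1) ^ l *
     (pochhammer (- of_nat n) l * pochhammer (- of_real \<omega>) l) /
     (fact l * pochhammer (- of_nat n - of_real \<omega>) l)" for l
  have "coeff (P \<omega> n) (n - l) = (\<Sum>l'\<le>n. coeff (monom (c l') (n - l')) (n - l))"
    by (simp add: P_def coeff_sum c_def)
  also have "\<dots> = (\<Sum>l'\<le>n. if l' = l then c l' else 0)"
    using assms by (intro sum.cong refl) (auto simp: coeff_monom)
  also have "\<dots> = c l"
    using assms by simp
  finally show ?thesis by (simp add: c_def)
qed

lemma coeff_P_eq_0: "i > n \<Longrightarrow> coeff (P \<omega> n) i = 0"
  unfolding P_def by (auto simp: coeff_sum intro!: sum.neutral)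

lemma pochhammer_of_real_nonzero:
  assumes "x > 0"
  shows "pochhammer (of_real x :: complex) n \<noteq> 0"
  using pochhammer_pos[OF assms, of n] by (metis less_irrefl of_real_eq_0_iff pochhammer_of_real)

text \<open>Trading Pochhammer symbols of length \<open>l\<close> for ones of length
  \<open>n\<close> makes the numerator a polynomial in \<open>l\<close>, as the finite difference
  argument requires. Positivity of \<open>\<omega>\<close> keeps both denominators nonzero.\<close>

lemma coeff_P_binomial:
  assumes "\<omega> > 0" "l \<le> n"
  shows "coeff (P \<omega> n) (n - l) =
     of_nat (n choose l) * pochhammer (of_real \<omega> - of_nat l + 1) n / pochhammer (of_real \<omega> + 1) n"
proof -
  define w :: complex where "w = of_real \<omega>"
  have 1: "of_nat (n choose l) = (-1) ^ l * pochhammer (- of_nat n :: complex) l / fact l"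
    by (simp add: binomial_gbinomial gbinomial_pochhammer)
  have 2: "pochhammer (- w) l = (-1) ^ l * pochhammer (w - of_nat l + 1) l"
    by (simp add: pochhammer_minus)
  have 3: "pochhammer (- of_nat n - w) l
      = (-1) ^ l * pochhammer (w - of_nat l + 1 + of_nat n) l"
  proof -
    have "- of_nat n - w = - (of_nat n + w)"
      "w - of_nat l + 1 + of_nat n = (of_nat n + w) - of_nat l + 1" by simp_all
    then show ?thesis by (simp only: pochhammer_minus)
  qed
  \<comment> \<open>Both sides equal \<open>pochhammer (w - of_nat l + 1) (l + n)\<close>, split
    after \<open>l\<close> factors on the left and after \<open>n\<close> on the right.\<close>
  have 4: "pochhammer (w - of_nat l + 1) l * pochhammer (w + 1) n
      = pochhammer (w - of_nat l + 1) n * pochhammer (w - of_nat l + 1 + of_nat n) l"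
    using pochhammer_product'[of "w - of_nat l + 1" l n]
      pochhammer_product'[of "w - of_nat l + 1" n l] by (simp add: add.commute)
  have 5: "pochhammer (w + 1) n \<noteq> 0"
    using pochhammer_of_real_nonzero[of "\<omega> + 1" n] assms by (simp add: w_def)
  have 6: "pochhammer (w - of_nat l + 1 + of_nat n) l \<noteq> 0"
    using pochhammer_of_real_nonzero[of "\<omega> - real l + 1 + real n" l] assms by (simp add: w_def)
  have 7: "pochhammer (w - of_nat l + 1) l / pochhammer (w - of_nat l + 1 + of_nat n) l
      = pochhammer (w - of_nat l + 1) n / pochhammer (w + 1) n"
    using 4 5 6 by (simp add: frac_eq_eq)
  have "coeff (P \<omega> n) (n - l) = of_nat (n choose l) *
      (pochhammer (w - of_nat l + 1) l / pochhammer (w - of_nat l + 1 + of_nat n) l)"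
    unfolding coeff_P[OF assms(2)] 1 w_def[symmetric] 2 3 by simp
  then show ?thesis unfolding 7 by (simp add: w_def)
qed

section \<open>Orthogonality\<close>

text \<open>Integer \<open>\<omega>\<close> is covered too: the factor
  \<open>\<omega> + real (n - l) - real k\<close> may then vanish, but it is only ever multiplied
  with the moment, never divided by.\<close>

lemma ip_P_monom:
  assumes "\<omega> > 0" "k < n"
  shows "ip \<omega> (P \<omega> n) (monom 1 k) = 0"
proof -
  define w :: complex where "w = of_real \<omega>"
  \<comment> \<open>The omitted index \<open>n - Suc k\<close> is that of the factor
    \<open>w + n - l - k\<close>, which cancels the denominator of the moment. The remaining
    \<open>n - 1\<close> factors form a polynomial in \<open>l\<close>.\<close>
  define q where "q = (\<Prod>i\<in>{0..<n} - {n - Suc k}. [:w + 1 + of_nat i, -1:])"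
  \<comment> \<open>Everything in the summand that does not depend on \<open>l\<close>.\<close>
  define C where
    "C = 2 * of_real (sin (pi * \<omega>)) * (-1) ^ (n + k) / pochhammer (w + 1) n"
  define I where
    "I j = integral {-pi..pi} (\<lambda>\<theta>. cis ((\<omega> + real j - real k) * \<theta>))" for j
  have deg: "degree q < n"
    using assms(2) unfolding q_def by (subst degree_prod_eq_sum_degree) auto
  have poch: "pochhammer (w - of_nat l + 1) n
      = of_real (\<omega> + real (n - l) - real k) * poly q (of_nat l)" if "l \<le> n" for l
  proof -
    have "n - Suc k \<in> {0..<n}" using assms(2) by simp
    then have "pochhammer (w - of_nat l + 1) n
        = (w - of_nat l + 1 + of_nat (n - Suc k))
          * (\<Prod>i\<in>{0..<n} - {n - Suc k}. w - of_nat l + 1 + of_nat i)"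
      unfolding pochhammer_prod by (intro prod.remove) auto
    moreover have "w - of_nat l + 1 + of_nat (n - Suc k) = of_real (\<omega> + real (n - l) - real k)"
      using assms(2) that by (simp add: w_def of_nat_diff)
    moreover have "w - of_nat l + 1 + of_nat i = w + 1 + of_nat i - of_nat l" for i
      by simp
    ultimately show ?thesis
      by (simp add: q_def poly_prod)
  qed
  have "2 * of_real pi * ip \<omega> (P \<omega> n) (monom 1 k) = (\<Sum>j<Suc n. coeff (P \<omega> n) j * I j)"
    unfolding I_def by (rule ip_monom) (simp add: coeff_P_eq_0)
  also have "\<dots> = (\<Sum>l<Suc n. coeff (P \<omega> n) (n - l) * I (n - l))"
    using sum.nat_diff_reindex[of "\<lambda>j. coeff (P \<omega> n) j * I j" "Suc n"] by simp
  also have "\<dots> = (\<Sum>l\<le>n. C * ((-1) ^ l * of_nat (n choose l) * poly q (of_nat l)))"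
    unfolding lessThan_Suc_atMost
  proof (rule sum.cong[OF refl])
    fix l assume "l \<in> {..n}"
    then have l: "l \<le> n" by simp
    have sgn: "(-1) ^ (n - l + k) = (-1) ^ (n + k) * (-1 :: real) ^ l"
      using l by (simp add: minus_one_power_iff)
    have I: "of_real (\<omega> + real (n - l) - real k) * I (n - l)
        = 2 * of_real (sin (pi * \<omega>)) * (-1) ^ (n + k) * (-1) ^ l"
      unfolding I_def integral_cis sin_add_int_pi sgn by simp
    have "coeff (P \<omega> n) (n - l) * I (n - l) = of_nat (n choose l) * poly q (of_nat l) *
        (of_real (\<omega> + real (n - l) - real k) * I (n - l)) / pochhammer (w + 1) n"
      unfolding coeff_P_binomial[OF assms(1) l] w_def[symmetric] poch[OF l]
      by (simp only: times_divide_eq_left times_divide_eq_right mult_ac)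
    also have "\<dots> = C * ((-1) ^ l * of_nat (n choose l) * poly q (of_nat l))"
      unfolding I C_def by (simp only: times_divide_eq_left times_divide_eq_right mult_ac)
    finally show "coeff (P \<omega> n) (n - l) * I (n - l)
        = C * ((-1) ^ l * of_nat (n choose l) * poly q (of_nat l))" .
  qed
  also have "\<dots> = 0"
    using alternating_binomial_sum_poly[OF deg] by (simp flip: sum_distrib_left)
  finally show ?thesis by simp
qed

section \<open>Uniqueness for non-integer \<open>\<omega>\<close>\<close>

text \<open>Here \<open>sin (pi * \<omega>)\<close> is nonzero, so after removing the common factor
  and the sign in \<open>k\<close> the relations form a Cauchy system for
  \<open>(-1) ^ j * coeff d j\<close>. Bounding the degree through coefficients includes
  \<open>n = 0\<close>, where \<open>degree d < n\<close> would be unsatisfiable.\<close>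

lemma ip_monom_nondegenerate:
  assumes "\<omega> \<notin> \<int>"
    and deg: "\<And>j. j \<ge> n \<Longrightarrow> coeff d j = 0"
    and orth: "\<And>k. k < n \<Longrightarrow> ip \<omega> d (monom 1 k) = 0"
  shows "d = 0"
proof -
  define w :: complex where "w = of_real \<omega>"
  define I where "I s = integral {-pi..pi} (\<lambda>\<theta>. cis (s * \<theta>))" for s
  have nzr: "\<omega> + real j - real k \<noteq> 0" for j k
  proof
    assume "\<omega> + real j - real k = 0"
    then have "\<omega> = real k - real j" by simp
    then show False using assms(1) by (simp add: Ints_diff)
  qed
  have cast: "w + of_nat j - of_nat k = of_real (\<omega> + real j - real k)" for j k
    by (simp add: w_def)
  have nz: "w + of_nat j - of_nat k \<noteq> 0" for j k
    unfolding cast of_real_eq_0_iff by (rule nzr)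
  have sin_nz: "sin (pi * \<omega>) \<noteq> 0"
  proof
    assume "sin (pi * \<omega>) = 0"
    then obtain i where "pi * \<omega> = of_int i * pi" by (auto simp: sin_zero_iff_int2)
    then show False using assms(1) by (simp add: mult.commute)
  qed
  have I: "I (\<omega> + real j - real k)
      = 2 * of_real (sin (pi * \<omega>)) * (-1) ^ k * ((-1) ^ j / (w + of_nat j - of_nat k))" for j k
  proof -
    have "(w + of_nat j - of_nat k) * I (\<omega> + real j - real k)
        = 2 * of_real (sin (pi * \<omega>)) * (-1) ^ k * (-1) ^ j"
      unfolding cast I_def integral_cis sin_add_int_pi by (simp add: power_add)
    then show ?thesis using nz[of j k] by (simp add: field_simps)
  qed
  have "(-1) ^ m * coeff d m = 0" if "m < n" for m
  proof (rule cauchy_system_trivial[OF nz _ that])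
    fix k assume "k < n"
    have "0 = 2 * of_real pi * ip \<omega> d (monom 1 k)"
      using orth[OF \<open>k < n\<close>] by simp
    also have "\<dots> = (\<Sum>j<n. coeff d j * I (\<omega> + real j - real k))"
      unfolding I_def using deg by (rule ip_monom)
    also have "\<dots> = 2 * of_real (sin (pi * \<omega>)) * (-1) ^ k
        * (\<Sum>j<n. (-1) ^ j * coeff d j / (w + of_nat j - of_nat k))"
      unfolding I sum_distrib_left by (intro sum.cong) (auto simp: mult_ac)
    finally show "(\<Sum>j<n. (-1) ^ j * coeff d j / (w + of_nat j - of_nat k)) = 0"
      using sin_nz by simp
  qed
  then show ?thesis
    using deg by (intro poly_eqI) (metis coeff_0 mult_eq_0_iff not_le power_not_zero
        neg_equal_0_iff_equal zero_neq_one)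
qed

section \<open>Monicity, hypergeometric form and conclusion\<close>

lemma monic_P:
  assumes "\<omega> > 0"
  shows "degree (P \<omega> n) = n" "lead_coeff (P \<omega> n) = 1"
proof -
  have top: "coeff (P \<omega> n) n = 1"
    using coeff_P[of 0 n \<omega>] by simp
  show *: "degree (P \<omega> n) = n"
    by (metis antisym coeff_P_eq_0 degree_le le_degree top zero_neq_one)
  show "lead_coeff (P \<omega> n) = 1"
    using top unfolding * .
qed

lemma poly_P_hyp2F1:
  assumes "z \<noteq> 0"
  shows "poly (P \<omega> n) z =
    z ^ n * hyp2F1 (- of_nat n) (- of_real \<omega>) (- of_nat n - of_real \<omega>) (- 1 / z)"
proof -
  define c where "c l = (pochhammer (- of_nat n) l * pochhammer (- of_real \<omega>) l) /
     (fact l * pochhammer (- of_nat n - of_real \<omega> :: complex) l)" for l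
  have "hyp2F1 (- of_nat n) (- of_real \<omega>) (- of_nat n - of_real \<omega>) (- 1 / z)
      = (\<Sum>l. c l * (- 1 / z) ^ l)"
    by (simp add: hyp2F1_def eval_fps_def c_def fps_hypergeo_nth mult.commute)
  \<comment> \<open>The series terminates because \<open>pochhammer (- of_nat n) l\<close> vanishes
    for \<open>l > n\<close>.\<close>
  also have "\<dots> = (\<Sum>l\<le>n. c l * (- 1 / z) ^ l)"
    by (rule suminf_finite) (auto simp: c_def pochhammer_of_nat_eq_0_iff)
  finally have "z ^ n * hyp2F1 (- of_nat n) (- of_real \<omega>) (- of_nat n - of_real \<omega>) (- 1 / z)
      = (\<Sum>l\<le>n. c l * (z ^ n * (- 1 / z) ^ l))"
    by (simp add: sum_distrib_left mult_ac)
  also have "\<dots> = (\<Sum>l\<le>n. (-1) ^ l * c l * z ^ (n - l))"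
  proof (rule sum.cong[OF refl])
    fix l assume "l \<in> {..n}"
    then have "z ^ n = z ^ (n - l) * z ^ l" by (simp flip: power_add)
    moreover have "(- 1 / z) ^ l = (-1) ^ l / z ^ l" by (rule power_divide)
    ultimately show "c l * (z ^ n * (- 1 / z) ^ l) = (-1) ^ l * c l * z ^ (n - l)"
      using assms by simp
  qed
  also have "\<dots> = poly (P \<omega> n) z"
    by (simp add: P_def poly_sum poly_monom c_def)
  finally show ?thesis by simp
qed

theorem theorem1:
  fixes \<omega> :: real and n :: nat
  assumes "\<omega> > 0"
  shows "(\<forall>z. z \<noteq> 0 \<longrightarrow> poly (P \<omega> n) z =
            z ^ n * hyp2F1 (- of_nat n) (- of_real \<omega>) (- of_nat n - of_real \<omega>) (- 1 / z))
       \<and> degree (P \<omega> n) = n \<and> lead_coeff (P \<omega> n) = 1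
       \<and> (\<forall>k<n. ip \<omega> (P \<omega> n) (monom 1 k) = 0)
       \<and> (\<omega> \<notin> \<int> \<longrightarrow>
            (\<forall>p. monic_orthogonal \<omega> n p \<longrightarrow> p = P \<omega> n) \<and> skyburst \<omega> n = P \<omega> n)"
proof -
  have mo: "monic_orthogonal \<omega> n (P \<omega> n)"
    using monic_P[OF assms] ip_P_monom[OF assms] by (simp add: monic_orthogonal_def)
  have uniq: "p = P \<omega> n" if "\<omega> \<notin> \<int>" and p: "monic_orthogonal \<omega> n p" for p
  proof -
    have "p - P \<omega> n = 0"
    proof (rule ip_monom_nondegenerate[OF that(1)])
      \<comment> \<open>At \<open>j = n\<close> the two leading coefficients, both 1, cancel; beyond
        that both coefficients are zero.\<close>
      fix j assume "j \<ge> n"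
      then show "coeff (p - P \<omega> n) j = 0"
        using p mo by (cases "j = n") (auto simp: monic_orthogonal_def coeff_eq_0)
    next
      fix k assume "k < n"
      then show "ip \<omega> (p - P \<omega> n) (monom 1 k) = 0"
        using p mo by (simp add: monic_orthogonal_def ip_diff_monom)
    qed
    then show ?thesis by simp
  qed
  then have "skyburst \<omega> n = P \<omega> n" if "\<omega> \<notin> \<int>"
    unfolding skyburst_def using mo that by blast
  with uniq show ?thesis
    using monic_P[OF assms] ip_P_monom[OF assms] poly_P_hyp2F1 by (intro conjI allI impI)
qed

end
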